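(* The Schur property and the positive Schur property are 3-lattice properties. That is, for every Banach lattice $E$ and every closed ideal $I$ of $E$: if two of the Banach lattices $E$, $I$ and $E/I$ have the Schur property, then the third one has the Schur property as well; and if two of the Banach lattices $E$, $I$ and $E/I$ have the positive Schur property, then the third one has the positive Schur property as well.
   Context: A Banach lattice (or Banach space) has the Schur property if every weakly null sequence in it is norm null. A Banach lattice has the positive Schur property if every weakly null sequence formed by positive vectors is norm null. A property $\mathcal{P}$ of Banach lattices is a 3-lattice property if, given a closed ideal $I$ of a Banach lattice $E$, whenever two of the lattices $E$, $I$ and $E/I$ have $\mathcal{P}$, the third one has $\mathcal{P}$ as well. The quotient $E/I$ is a Banach lattice with the quotient norm and the quotient order ($\dot x\le\dot y$ if there are $x_1\in\dot x$, $y_1\in\dot y$ with $x_1\le y_1$). *)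

theory Defs
  imports "HOL-Analysis.Analysis" "HOL-Library.Lattice_Algebras"
begin

class banach_lattice = banach + ordered_real_vector + lattice_ab_group_add_abs +
  assumes norm_lattice: "\<bar>x\<bar> \<le> \<bar>y\<bar> \<Longrightarrow> norm x \<le> norm y"

definition closed_ideal :: "'a::banach_lattice set \<Rightarrow> bool" where
  "closed_ideal I \<longleftrightarrow>
     subspace I \<and> (\<forall>x y. y \<in> I \<and> \<bar>x\<bar> \<le> \<bar>y\<bar> \<longrightarrow> x \<in> I) \<and> closed I"

text \<open>
  The quotient of a Banach lattice by an ideal is not a type, so the Schur properties are
  defined for ordered normed spaces given by an explicit carrier. They are only applied to the
  three structures built below from a type of class \<open>banach_lattice\<close>.
\<close>

record 'a normed_order =
  no_carrier :: "'a set"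
  no_add :: "'a \<Rightarrow> 'a \<Rightarrow> 'a"
  no_scale :: "real \<Rightarrow> 'a \<Rightarrow> 'a"
  no_zero :: 'a
  no_norm :: "'a \<Rightarrow> real"
  no_le :: "'a \<Rightarrow> 'a \<Rightarrow> bool"

text \<open>Only the values of \<open>f\<close> on the carrier matter.\<close>

definition bounded_functional :: "'a normed_order \<Rightarrow> ('a \<Rightarrow> real) \<Rightarrow> bool" where
  "bounded_functional X f \<longleftrightarrow>
     (\<forall>x\<in>no_carrier X. \<forall>y\<in>no_carrier X. f (no_add X x y) = f x + f y) \<and>
     (\<forall>c. \<forall>x\<in>no_carrier X. f (no_scale X c x) = c * f x) \<and>
     (\<exists>K. \<forall>x\<in>no_carrier X. \<bar>f x\<bar> \<le> K * no_norm X x)"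

definition weakly_null :: "'a normed_order \<Rightarrow> (nat \<Rightarrow> 'a) \<Rightarrow> bool" where
  "weakly_null X u \<longleftrightarrow>
     (\<forall>n. u n \<in> no_carrier X) \<and>
     (\<forall>f. bounded_functional X f \<longrightarrow> (\<lambda>n. f (u n)) \<longlonglongrightarrow> 0)"

definition norm_null :: "'a normed_order \<Rightarrow> (nat \<Rightarrow> 'a) \<Rightarrow> bool" where
  "norm_null X u \<longleftrightarrow>
     (\<forall>n. u n \<in> no_carrier X) \<and> (\<lambda>n. no_norm X (u n)) \<longlonglongrightarrow> 0"

definition schur_property :: "'a normed_order \<Rightarrow> bool" where
  "schur_property X \<longleftrightarrow> (\<forall>u. weakly_null X u \<longrightarrow> norm_null X u)"

definition positive_schur_property :: "'a normed_order \<Rightarrow> bool" where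
  "positive_schur_property X \<longleftrightarrow>
     (\<forall>u. weakly_null X u \<and> (\<forall>n. no_le X (no_zero X) (u n)) \<longrightarrow> norm_null X u)"

definition whole_space :: "'a::banach_lattice normed_order" where
  "whole_space =
     \<lparr>no_carrier = UNIV, no_add = (+), no_scale = (*\<^sub>R), no_zero = 0,
      no_norm = norm, no_le = (\<le>)\<rparr>"

definition ideal_space :: "'a::banach_lattice set \<Rightarrow> 'a normed_order" where
  "ideal_space I = whole_space\<lparr>no_carrier := I\<rparr>"

definition coset :: "'a::banach_lattice set \<Rightarrow> 'a \<Rightarrow> 'a set" where
  "coset I x = {x + y | y. y \<in> I}"

text \<open>
  In the scalar multiplication, \<open>I\<close> is added so that the result is a coset also for \<open>c = 0\<close>.
  The infimum of the norms over a coset is the quotient norm of that coset.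
\<close>

definition quotient_space :: "'a::banach_lattice set \<Rightarrow> 'a set normed_order" where
  "quotient_space I =
     \<lparr>no_carrier = range (coset I),
      no_add = (\<lambda>A B. {a + b | a b. a \<in> A \<and> b \<in> B}),
      no_scale = (\<lambda>c A. {c *\<^sub>R a + y | a y. a \<in> A \<and> y \<in> I}),
      no_zero = coset I 0,
      no_norm = (\<lambda>A. INF a\<in>A. norm a),
      no_le = (\<lambda>A B. \<exists>a\<in>A. \<exists>b\<in>B. a \<le> b)\<rparr>"

lemma bounded_functional_whole_space:
  "bounded_functional whole_space f \<longleftrightarrow> bounded_linear f"
proof
  assume f: "bounded_functional whole_space f"
  then obtain K where "\<And>x. \<bar>f x\<bar> \<le> K * norm x"
    by (auto simp: bounded_functional_def whole_space_def)
  with f show "bounded_linear f"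
    by (intro bounded_linear_intro[of f K])
      (auto simp: bounded_functional_def whole_space_def mult.commute)
next
  assume "bounded_linear f"
  then interpret bounded_linear f .
  obtain K where "\<And>x. norm (f x) \<le> norm x * K" using bounded by blast
  then show "bounded_functional whole_space f"
    by (auto simp: bounded_functional_def whole_space_def add scaleR mult.commute
        intro!: exI[of _ K])
qed

lemma quotient_add_coset:
  assumes "closed_ideal I"
  shows "no_add (quotient_space I) (coset I x) (coset I y) = coset I (x + y)"
proof -
  have I: "subspace I" using assms by (simp add: closed_ideal_def)
  show ?thesis
  proof (intro equalityI subsetI)
    fix z assume "z \<in> no_add (quotient_space I) (coset I x) (coset I y)"
    then obtain a b where "a \<in> I" "b \<in> I" "z = (x + a) + (y + b)"
      by (auto simp: quotient_space_def coset_def)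
    then have "z = (x + y) + (a + b)" "a + b \<in> I"
      using I by (auto simp: algebra_simps subspace_add)
    then show "z \<in> coset I (x + y)" by (auto simp: coset_def)
  next
    fix z assume "z \<in> coset I (x + y)"
    then obtain a where "a \<in> I" "z = x + (y + a)"
      by (auto simp: coset_def algebra_simps)
    moreover from \<open>a \<in> I\<close> have "x \<in> coset I x" "y + a \<in> coset I y"
      using subspace_0[OF I] by (auto simp: coset_def)
    ultimately show "z \<in> no_add (quotient_space I) (coset I x) (coset I y)"
      by (auto simp: quotient_space_def)
  qed
qed

lemma quotient_scale_coset:
  assumes "closed_ideal I"
  shows "no_scale (quotient_space I) c (coset I x) = coset I (c *\<^sub>R x)"
proof -
  have I: "subspace I" using assms by (simp add: closed_ideal_def)
  show ?thesis
  proof (intro equalityI subsetI)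
    fix z assume "z \<in> no_scale (quotient_space I) c (coset I x)"
    then obtain a b where "a \<in> I" "b \<in> I" "z = c *\<^sub>R (x + a) + b"
      by (auto simp: quotient_space_def coset_def)
    then have "z = c *\<^sub>R x + (c *\<^sub>R a + b)" "c *\<^sub>R a + b \<in> I"
      using I by (auto simp: algebra_simps subspace_add subspace_scale)
    then show "z \<in> coset I (c *\<^sub>R x)" by (auto simp: coset_def)
  next
    fix z assume "z \<in> coset I (c *\<^sub>R x)"
    then obtain a where "a \<in> I" "z = c *\<^sub>R x + a"
      by (auto simp: coset_def)
    moreover have "x \<in> coset I x"
      using subspace_0[OF I] by (auto simp: coset_def)
    ultimately show "z \<in> no_scale (quotient_space I) c (coset I x)"
      by (auto simp: quotient_space_def)
  qed
qed

lemma quotient_norm_coset: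
  "no_norm (quotient_space I) (coset I x) = (INF y\<in>I. norm (x + y))"
  by (auto simp: quotient_space_def coset_def image_def intro!: arg_cong[where f = Inf])

end

theory Submission
  imports Defs
begin

text \<open>
  If \<open>I\<close> has the positive Schur property, the increments of an increasing sequence of positive
  elements of \<open>I\<close> that is order bounded in \<open>E\<close> form a weakly null sequence, since their sums with
  arbitrary signs stay bounded. Hence such a sequence cannot have increments bounded away
  from \<open>0\<close>, and as \<open>I\<close> is closed, \<open>{y \<in> I. 0 \<le> y \<le> x}\<close> has a greatest element for every \<open>x \<ge> 0\<close>.
  So \<open>I\<close> is a projection band: there is a linear \<open>P\<close> from \<open>E\<close> onto \<open>I\<close> with
  \<open>\<bar>x\<bar> = \<bar>P x\<bar> + \<bar>x - P x\<bar>\<close>. The quotient \<open>E/I\<close> is then isometric to the range of \<open>1 - P\<close>, and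
  functionals extend from \<open>I\<close> and from this range to \<open>E\<close> by composition with \<open>P\<close> and \<open>1 - P\<close>, so
  that the Hahn-Banach theorem is not needed.
\<close>

section \<open>Banach lattices\<close>

lemma norm_abs_lattice: "norm \<bar>x\<bar> = norm (x::'a::banach_lattice)"
  by (intro antisym norm_lattice) simp_all

lemma norm_mono_nonneg:
  fixes x y :: "'a::banach_lattice"
  assumes "0 \<le> x" "x \<le> y"
  shows "norm x \<le> norm y"
  using assms by (intro norm_lattice) simp

lemma abs_scaleR_le: "\<bar>c *\<^sub>R x\<bar> \<le> \<bar>c\<bar> *\<^sub>R \<bar>x::'a::banach_lattice\<bar>"
proof (rule abs_leI)
  have "\<bar>c\<bar> *\<^sub>R x \<le> \<bar>c\<bar> *\<^sub>R \<bar>x\<bar>" "\<bar>c\<bar> *\<^sub>R (- x) \<le> \<bar>c\<bar> *\<^sub>R \<bar>x\<bar>"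
    by (intro scaleR_left_mono abs_ge_self abs_ge_minus_self abs_ge_zero)+
  then show "c *\<^sub>R x \<le> \<bar>c\<bar> *\<^sub>R \<bar>x\<bar>" "- (c *\<^sub>R x) \<le> \<bar>c\<bar> *\<^sub>R \<bar>x\<bar>"
    by (cases "c \<ge> 0"; simp)+
qed

text \<open>The left side is below \<open>inf x y + x\<close> and below \<open>inf x y + z\<close>,
  hence below their infimum, which is \<open>inf x y + inf x z\<close> by translation invariance.
  This is what makes sums of elements disjoint from I disjoint from I.\<close>

lemma inf_add_le:
  fixes x y z :: "'a::lattice_ab_group_add"
  assumes "0 \<le> x" "0 \<le> y" "0 \<le> z"
  shows "inf x (y + z) \<le> inf x y + inf x z"
proof -
  have "inf x (y + z) \<le> inf x y + x"
    using assms by (intro le_infI1) (simp add: add_increasing)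
  moreover have "inf x (y + z) \<le> inf x y + z"
    using assms by (auto simp: add_inf_distrib_right intro: le_infI1 le_infI2 add_increasing2)
  ultimately show ?thesis by (simp add: add_inf_distrib_left)
qed

text \<open>The negative part \<open>sup (- l) 0\<close> of the limit is dominated by the modulus of
  \<open>u n - l\<close>, so its norm is 0.\<close>

lemma tendsto_nonneg_lattice:
  fixes u :: "nat \<Rightarrow> 'a::banach_lattice"
  assumes lim: "u \<longlonglongrightarrow> l" and nonneg: "\<And>n. 0 \<le> u n"
  shows "0 \<le> l"
proof -
  have le: "norm (sup (- l) 0) \<le> norm (u n - l)" for n
  proof -
    have "- l \<le> u n - l" using nonneg[of n] by simp
    then have "sup (- l) 0 \<le> \<bar>u n - l\<bar>"
      by (intro sup_least) (auto intro: order_trans[OF _ abs_ge_self])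
    then show ?thesis
      by (subst norm_abs_lattice[of "u n - l", symmetric], intro norm_mono_nonneg) auto
  qed
  have "(\<lambda>n. norm (u n - l)) \<longlonglongrightarrow> 0"
    using lim by (simp add: LIM_zero_iff tendsto_norm_zero)
  then have "norm (sup (- l) 0) \<le> 0"
    using le by (intro LIMSEQ_le_const) auto
  then have "sup (- l) 0 = 0" by simp
  then have "- l \<le> 0" by (metis sup_ge1)
  then show ?thesis by simp
qed

section \<open>Ideals with the positive Schur property are projection bands\<close>

text \<open>The bound \<open>x\<close> may lie outside I. For each bounded functional f on I, the
  values of f along \<open>u\<close> are absolutely summable, which gives weak nullity.\<close>

lemma increments_null:
  fixes I :: "'a::banach_lattice set"
  assumes I: "closed_ideal I" and schur: "positive_schur_property (ideal_space I)"
    and u: "\<And>n. u n \<in> I" "\<And>n. 0 \<le> u n" and le: "\<And>n. (\<Sum>k<n. u k) \<le> x"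
  shows "(\<lambda>n. norm (u n)) \<longlonglongrightarrow> 0"
proof -
  have sub: "subspace I" using I by (simp add: closed_ideal_def)
  have "weakly_null (ideal_space I) u"
    unfolding weakly_null_def
  proof (intro conjI allI impI)
    show "u n \<in> no_carrier (ideal_space I)" for n
      using u by (simp add: ideal_space_def whole_space_def)
    fix f assume "bounded_functional (ideal_space I) f"
    then obtain K where add: "\<And>a b. a \<in> I \<Longrightarrow> b \<in> I \<Longrightarrow> f (a + b) = f a + f b"
      and scale: "\<And>c a. a \<in> I \<Longrightarrow> f (c *\<^sub>R a) = c * f a"
      and K: "\<And>a. a \<in> I \<Longrightarrow> \<bar>f a\<bar> \<le> K * norm a"
      by (simp add: bounded_functional_def ideal_space_def whole_space_def) blast
    have bound: "(\<Sum>k<n. \<bar>f (u k)\<bar>) \<le> \<bar>K\<bar> * norm x" for n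
    proof -
      \<comment> \<open>With these signs, f of the sum becomes the sum of the absolute values of
        \<open>f (u k)\<close>, while the modulus of the sum is still at most the unsigned sum and
        so at most \<open>x\<close>.\<close>
      define s where "s n = (\<Sum>k<n. sgn (f (u k)) *\<^sub>R u k)" for n
      have sI: "s m \<in> I" for m
        unfolding s_def using u sub by (intro subspace_sum subspace_scale) auto
      have fs: "f (s m) = (\<Sum>k<m. \<bar>f (u k)\<bar>)" for m
      proof (induction m)
        case 0
        show ?case using scale[of 0 0] subspace_0[OF sub] by (simp add: s_def)
      next
        case (Suc m)
        have "s (Suc m) = s m + sgn (f (u m)) *\<^sub>R u m" by (simp add: s_def)
        then show ?case
          using Suc add[OF sI[of m] subspace_scale[OF sub u(1)[of m]]] scale[OF u(1)[of m]]
          by (simp add: sgn_mult_self_eq mult.commute abs_sgn)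
      qed
      have "\<bar>s n\<bar> \<le> (\<Sum>k<n. \<bar>sgn (f (u k)) *\<^sub>R u k\<bar>)"
        unfolding s_def by (rule sum_abs)
      also have "\<dots> \<le> (\<Sum>k<n. u k)"
      proof (rule sum_mono)
        fix k
        have "\<bar>sgn (f (u k)) *\<^sub>R u k\<bar> \<le> \<bar>sgn (f (u k))\<bar> *\<^sub>R u k"
          using abs_scaleR_le[of "sgn (f (u k))" "u k"] unfolding abs_of_nonneg[OF u(2)] .
        also have "\<dots> \<le> u k" using u(2)[of k] by (simp add: abs_sgn_eq)
        finally show "\<bar>sgn (f (u k)) *\<^sub>R u k\<bar> \<le> u k" .
      qed
      also have "\<dots> \<le> x" by (rule le)
      finally have "norm (s n) \<le> norm x"
        by (intro norm_lattice order_trans[OF _ abs_ge_self])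
      then have "K * norm (s n) \<le> \<bar>K\<bar> * norm x" by (intro mult_mono) auto
      then show ?thesis using K[OF sI[of n]] by (simp add: fs)
    qed
    have "summable (\<lambda>n. \<bar>f (u n)\<bar>)"
      using bound by (intro summableI_nonneg_bounded[where x = "\<bar>K\<bar> * norm x"]) auto
    then have "(\<lambda>n. \<bar>f (u n)\<bar>) \<longlonglongrightarrow> 0" by (rule summable_LIMSEQ_zero)
    then show "(\<lambda>n. f (u n)) \<longlonglongrightarrow> 0" by (simp add: tendsto_rabs_zero_iff)
  qed
  then have "norm_null (ideal_space I) u"
    using schur u(2) by (simp add: positive_schur_property_def ideal_space_def whole_space_def)
  then show ?thesis by (simp add: norm_null_def ideal_space_def whole_space_def)
qed

lemma greatest_below:
  fixes I :: "'a::banach_lattice set"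
  assumes I: "closed_ideal I" and schur: "positive_schur_property (ideal_space I)"
    and x: "0 \<le> x"
  obtains p where "p \<in> I" "p \<le> x" "\<And>y. y \<in> I \<Longrightarrow> 0 \<le> y \<Longrightarrow> y \<le> x \<Longrightarrow> y \<le> p"
proof -
  have sub: "subspace I" and cl: "closed I"
    and ideal: "\<And>a b. b \<in> I \<Longrightarrow> \<bar>a\<bar> \<le> \<bar>b\<bar> \<Longrightarrow> a \<in> I"
    using I unfolding closed_ideal_def by blast+
  define D where "D = {y \<in> I. 0 \<le> y \<and> y \<le> x}"
  have D0: "0 \<in> D" using x subspace_0[OF sub] by (simp add: D_def)
  have D_sup: "sup a b \<in> D" if "a \<in> D" "b \<in> D" for a b
  proof -
    have "0 \<le> a" "0 \<le> b" using that by (auto simp: D_def)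
    then have "sup a b \<le> a + b" "0 \<le> sup a b" by (auto intro: le_supI1)
    have "sup a b \<in> I"
      by (rule ideal[of "a + b"])
        (use that sub \<open>sup a b \<le> a + b\<close> \<open>0 \<le> sup a b\<close> \<open>0 \<le> a\<close> \<open>0 \<le> b\<close> in \<open>auto simp: D_def subspace_add\<close>)
    then show ?thesis using that \<open>0 \<le> sup a b\<close> by (simp add: D_def)
  qed
  \<comment> \<open>Otherwise every element of \<open>D\<close> above \<open>y0\<close> could be
    raised within \<open>D\<close> by a step of norm at least \<open>e\<close>; iterating yields a
    chain whose increments contradict \<open>increments_null\<close>.\<close>
  have ex: "\<exists>y\<in>D. y0 \<le> y \<and> (\<forall>z\<in>D. y \<le> z \<longrightarrow> norm (z - y) < e)" if "y0 \<in> D" "0 < e" for y0 e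
  proof (rule ccontr)
    assume neg: "\<not> ?thesis"
    have "\<exists>s. \<forall>n. (s n \<in> D \<and> y0 \<le> s n) \<and> (s n \<le> s (Suc n) \<and> e \<le> norm (s (Suc n) - s n))"
    proof (rule dependent_nat_choice)
      show "\<exists>y. y \<in> D \<and> y0 \<le> y" using that by blast
      fix y and n :: nat assume "y \<in> D \<and> y0 \<le> y"
      then show "\<exists>z. (z \<in> D \<and> y0 \<le> z) \<and> y \<le> z \<and> e \<le> norm (z - y)"
        using neg by (metis linorder_not_less order_trans)
    qed
    then obtain s where s: "\<And>n. s n \<in> D" "\<And>n. s n \<le> s (Suc n)"
      "\<And>n. e \<le> norm (s (Suc n) - s n)" by blast
    have "(\<Sum>k<n. s (Suc k) - s k) \<le> x" for n
    proof -
      \<comment> \<open>The increments telescope to \<open>s n - s 0\<close>, and \<open>s 0\<close>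
        is nonnegative.\<close>
      have "s n \<le> x + s 0" using s(1)[of n] s(1)[of 0] by (auto simp: D_def add_increasing2)
      then show ?thesis by (simp add: sum_lessThan_telescope diff_le_eq)
    qed
    then have "(\<lambda>n. norm (s (Suc n) - s n)) \<longlonglongrightarrow> 0"
      using s sub by (intro increments_null[OF I schur, where x = x]) (auto simp: D_def subspace_diff)
    then have "e \<le> 0" using s(3) by (intro LIMSEQ_le_const) auto
    then show False using that by simp
  qed
  \<comment> \<open>Above \<open>s n\<close> there is almost no room left in \<open>D\<close>. This
    makes \<open>s\<close> a Cauchy sequence and also forces its limit to dominate all of
    \<open>D\<close>.\<close>
  have "\<exists>s. \<forall>n. (s n \<in> D \<and> (\<forall>z\<in>D. s n \<le> z \<longrightarrow> norm (z - s n) < (1/2)^n)) \<and> s n \<le> s (Suc n)"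
  proof (rule dependent_nat_choice)
    show "\<exists>y. y \<in> D \<and> (\<forall>z\<in>D. y \<le> z \<longrightarrow> norm (z - y) < (1/2)^0)"
      using ex[OF D0, of 1] by auto
    fix y n assume "y \<in> D \<and> (\<forall>z\<in>D. y \<le> z \<longrightarrow> norm (z - y) < (1/2::real)^n)"
    then show "\<exists>z. (z \<in> D \<and> (\<forall>w\<in>D. z \<le> w \<longrightarrow> norm (w - z) < (1/2)^Suc n)) \<and> y \<le> z"
      using ex[of y "(1/2)^Suc n"] by auto
  qed
  then obtain s where s: "\<And>n. s n \<in> D" "\<And>n. s n \<le> s (Suc n)"
    "\<And>n z. z \<in> D \<Longrightarrow> s n \<le> z \<Longrightarrow> norm (z - s n) < (1/2)^n" by blast
  have mono: "s m \<le> s n" if "m \<le> n" for m n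
    using s(2) that by (rule lift_Suc_mono_le)
  have small: "\<exists>N. (1/2::real)^N < e" if "0 < e" for e
    using real_arch_pow_inv[OF that, of "1/2"] by simp
  have "Cauchy s"
  proof (rule CauchyI')
    fix e :: real assume "0 < e"
    then obtain N where N: "(1/2::real)^N < e" using small by blast
    have "dist (s m) (s n) < e" if "N \<le> m" "m < n" for m n
    proof -
      have "norm (s n - s m) < (1/2)^m" using s that mono by simp
      also have "\<dots> \<le> (1/2)^N" using that by (intro power_decreasing) auto
      finally show ?thesis using N by (simp add: dist_norm norm_minus_commute)
    qed
    then show "\<exists>M. \<forall>m\<ge>M. \<forall>n>m. dist (s m) (s n) < e" by blast
  qed
  then obtain p where p: "s \<longlonglongrightarrow> p" using Cauchy_convergent convergent_def by blast
  have "p \<in> I" using cl s(1) p by (auto intro: closed_sequentially simp: D_def)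
  moreover have "p \<le> x"
  proof -
    have "(\<lambda>n. x - s n) \<longlonglongrightarrow> x - p" by (intro tendsto_intros p)
    then have "0 \<le> x - p"
      by (rule tendsto_nonneg_lattice) (use s(1) in \<open>auto simp: D_def\<close>)
    then show ?thesis by simp
  qed
  moreover have "y \<le> p" if "y \<in> I" "0 \<le> y" "y \<le> x" for y
  proof -
    have yD: "y \<in> D" using that by (simp add: D_def)
    \<comment> \<open>\<open>sup y (s n)\<close> is an element of \<open>D\<close> above
      \<open>s n\<close>, so it is within \<open>(1/2)^n\<close> of \<open>s n\<close>. Hence it
      also tends to \<open>p\<close>, while it stays above \<open>y\<close>.\<close>
    have "(\<lambda>n. sup y (s n) - s n) \<longlonglongrightarrow> 0"
    proof (rule Lim_null_comparison)
      show "\<forall>\<^sub>F n in sequentially. norm (sup y (s n) - s n) \<le> (1/2)^n"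
        using s D_sup yD by (intro always_eventually allI less_imp_le) auto
      show "(\<lambda>n. (1/2::real)^n) \<longlonglongrightarrow> 0" by (rule LIMSEQ_power_zero) simp
    qed
    from tendsto_diff[OF tendsto_add[OF this p] tendsto_const[of y]]
    have "0 \<le> 0 + p - y" by (rule tendsto_nonneg_lattice) simp
    then show ?thesis by simp
  qed
  ultimately show thesis using that by blast
qed

text \<open>The last assumption expresses that \<open>P x\<close> and \<open>x - P x\<close> are
  disjoint. It makes both \<open>P\<close> and \<open>1 - P\<close> positive and
  contractive.\<close>

locale ideal_projection =
  fixes I :: "'a::banach_lattice set" and P :: "'a \<Rightarrow> 'a"
  assumes ideal: "closed_ideal I" and lin: "linear P"
    and P_mem: "P x \<in> I" and P_id: "x \<in> I \<Longrightarrow> P x = x"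
    and abs_split: "\<bar>x\<bar> = \<bar>P x\<bar> + \<bar>x - P x\<bar>"

lemma ideal_projection_exists:
  fixes I :: "'a::banach_lattice set"
  assumes I: "closed_ideal I" and schur: "positive_schur_property (ideal_space I)"
  obtains P where "ideal_projection I P"
proof -
  have sub: "subspace I" and ideal: "\<And>a b. b \<in> I \<Longrightarrow> \<bar>a\<bar> \<le> \<bar>b\<bar> \<Longrightarrow> a \<in> I"
    using I unfolding closed_ideal_def by blast+
  \<comment> \<open>\<open>J\<close> is the disjoint complement of I: as I is an ideal,
    \<open>inf\<close> of the moduli of a in I and b is itself in I and below the modulus of b, so
    the condition on b forces it to be 0.\<close>
  define J where "J = {b. \<forall>y\<in>I. \<bar>y\<bar> \<le> \<bar>b\<bar> \<longrightarrow> y = 0}"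
  have inf0: "inf \<bar>a\<bar> \<bar>b\<bar> = 0" if "a \<in> I" "b \<in> J" for a b
  proof -
    have nonneg: "0 \<le> inf \<bar>a\<bar> \<bar>b\<bar>" by simp
    have "inf \<bar>a\<bar> \<bar>b\<bar> \<in> I" by (rule ideal[OF that(1)]) (simp add: abs_of_nonneg[OF nonneg])
    then show ?thesis using that nonneg by (auto simp: J_def)
  qed
  have J: "subspace J"
    unfolding subspace_def
  proof (intro conjI ballI allI)
    show "0 \<in> J" by (simp add: J_def)
    fix b assume b: "b \<in> J"
    show "b + c \<in> J" if "c \<in> J" for c
      unfolding J_def
    proof (intro CollectI ballI impI)
      fix y assume y: "y \<in> I" "\<bar>y\<bar> \<le> \<bar>b + c\<bar>"
      have "\<bar>y\<bar> \<le> \<bar>b\<bar> + \<bar>c\<bar>" by (rule order_trans[OF y(2) abs_triangle_ineq])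
      then have "\<bar>y\<bar> = inf \<bar>y\<bar> (\<bar>b\<bar> + \<bar>c\<bar>)" by (simp add: inf_absorb1)
      also have "\<dots> \<le> inf \<bar>y\<bar> \<bar>b\<bar> + inf \<bar>y\<bar> \<bar>c\<bar>" by (intro inf_add_le) auto
      also have "\<dots> = 0" using inf0 y b that by simp
      finally show "y = 0" by simp
    qed
    show "c *\<^sub>R b \<in> J" for c
      unfolding J_def
    proof (intro CollectI ballI impI)
      fix y assume y: "y \<in> I" "\<bar>y\<bar> \<le> \<bar>c *\<^sub>R b\<bar>"
      show "y = 0"
      proof (cases "c = 0")
        case False
        \<comment> \<open>Dividing by c moves y below the modulus of b without leaving I.\<close>
        have "\<bar>inverse c *\<^sub>R y\<bar> \<le> \<bar>inverse c\<bar> *\<^sub>R \<bar>y\<bar>" by (rule abs_scaleR_le)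
        also have "\<dots> \<le> \<bar>inverse c\<bar> *\<^sub>R \<bar>c\<bar> *\<^sub>R \<bar>b\<bar>"
          using y abs_scaleR_le[of c b] by (intro scaleR_left_mono) (auto intro: order_trans)
        also have "\<dots> = \<bar>b\<bar>" using False by simp
        finally have "inverse c *\<^sub>R y = 0"
          using b y sub by (auto simp: J_def simp del: scaleR_eq_0_iff intro: subspace_scale)
        then show ?thesis using False by simp
      qed (use y in auto)
    qed
  qed
  have split: "\<bar>a + b\<bar> = \<bar>a\<bar> + \<bar>b\<bar>" if "a \<in> I" "b \<in> J" for a b
  proof (rule antisym)
    \<comment> \<open>The modulus of c is below the sum of the moduli of \<open>c + d\<close> and d;
      being disjoint from the latter, it is below the former. Applied to both summands, this bounds
      the supremum of the two moduli, which for disjoint elements equals their sum.\<close>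
    have le: "\<bar>c\<bar> \<le> \<bar>c + d\<bar>" if "inf \<bar>c\<bar> \<bar>d\<bar> = 0" for c d :: 'a
    proof -
      have "\<bar>c\<bar> \<le> \<bar>c + d\<bar> + \<bar>d\<bar>" using abs_triangle_ineq4[of "c + d" d] by simp
      then have "\<bar>c\<bar> = inf \<bar>c\<bar> (\<bar>c + d\<bar> + \<bar>d\<bar>)" by (simp add: inf_absorb1)
      also have "\<dots> \<le> inf \<bar>c\<bar> \<bar>c + d\<bar> + inf \<bar>c\<bar> \<bar>d\<bar>" by (intro inf_add_le) auto
      also have "\<dots> \<le> \<bar>c + d\<bar>" using that by simp
      finally show ?thesis .
    qed
    have "\<bar>a\<bar> + \<bar>b\<bar> = sup \<bar>a\<bar> \<bar>b\<bar>"
      using add_eq_inf_sup[of "\<bar>a\<bar>" "\<bar>b\<bar>"] inf0[OF that] by simp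
    also have "\<dots> \<le> \<bar>a + b\<bar>"
      using le[of a b] le[of b a] inf0[OF that] by (simp add: inf_commute add.commute)
    finally show "\<bar>a\<bar> + \<bar>b\<bar> \<le> \<bar>a + b\<bar>" .
  qed (rule abs_triangle_ineq)
  have IJ: "a = 0" if "a \<in> I" "a \<in> J" for a
    using that by (auto simp: J_def)
  have ex_nonneg: "\<exists>p\<in>I. x - p \<in> J" if x: "0 \<le> x" for x
  proof -
    obtain p where p: "p \<in> I" "p \<le> x" "\<And>y. y \<in> I \<Longrightarrow> 0 \<le> y \<Longrightarrow> y \<le> x \<Longrightarrow> y \<le> p"
      using greatest_below[OF I schur x] by blast
    have p0: "0 \<le> p" using p(3)[of 0] x subspace_0[OF sub] by simp
    \<comment> \<open>If something nonzero of I fitted below \<open>x - p\<close>, adding its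
      modulus to \<open>p\<close> would give a larger element of I below x, against the choice of
      \<open>p\<close>.\<close>
    have "y = 0" if y: "y \<in> I" "\<bar>y\<bar> \<le> \<bar>x - p\<bar>" for y
    proof -
      have "\<bar>y\<bar> + p \<le> x" using y p(2) by (simp add: le_diff_eq)
      moreover have "\<bar>y\<bar> + p \<in> I" using y(1) p(1) sub ideal[of y "\<bar>y\<bar>"] by (auto intro: subspace_add)
      ultimately have "\<bar>y\<bar> + p \<le> p" using p0 by (intro p(3)) auto
      then show ?thesis by simp
    qed
    then show ?thesis using p(1) by (auto simp: J_def)
  qed
  have "\<exists>p\<in>I. x - p \<in> J" for x
  proof -
    \<comment> \<open>\<open>nprt x\<close> is \<open>inf x 0\<close>, hence nonpositive, and
      \<open>x = pprt x + nprt x\<close>; so the nonnegative case is applied to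
      \<open>- nprt x\<close>.\<close>
    obtain p q where p: "p \<in> I" "pprt x - p \<in> J" and q: "q \<in> I" "- nprt x - q \<in> J"
      using ex_nonneg[of "pprt x"] ex_nonneg[of "- nprt x"] by auto
    have "(pprt x - p) - (- nprt x - q) = (pprt x + nprt x) - (p - q)"
      by (simp add: algebra_simps)
    also have "\<dots> = x - (p - q)" by (simp only: prts[symmetric])
    finally have "x - (p - q) \<in> J" using subspace_diff[OF J p(2) q(2)] by (simp only:)
    then show ?thesis using subspace_diff[OF sub p(1) q(1)] by blast
  qed
  then obtain P where P: "\<And>x. P x \<in> I" "\<And>x. x - P x \<in> J" by metis
  \<comment> \<open>Two decompositions differ by an element of both I and \<open>J\<close>, which is
    0. Linearity of \<open>P\<close> follows from this uniqueness.\<close>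
  have uniq: "P x = p" if "p \<in> I" "x - p \<in> J" for x p
    using IJ[of "P x - p"] subspace_diff[OF sub P(1)[of x] that(1)]
      subspace_diff[OF J that(2) P(2)[of x]] by simp
  have "linear P"
  proof (rule linearI)
    show "P (x + y) = P x + P y" for x y
      using subspace_add[OF sub P(1) P(1)] subspace_add[OF J P(2)[of x] P(2)[of y]]
      by (intro uniq) (auto simp: algebra_simps)
    show "P (c *\<^sub>R x) = c *\<^sub>R P x" for c x
      using subspace_scale[OF sub P(1)] subspace_scale[OF J P(2)[of x], of c]
      by (intro uniq) (auto simp: algebra_simps)
  qed
  moreover have "P x = x" if "x \<in> I" for x
    using that subspace_0[OF J] by (intro uniq) auto
  moreover have "\<bar>x\<bar> = \<bar>P x\<bar> + \<bar>x - P x\<bar>" for x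
    using split[OF P(1)[of x] P(2)[of x]] by simp
  ultimately have "ideal_projection I P"
    using I P(1) by (rule_tac ideal_projection.intro)
  then show thesis by (rule that)
qed

section \<open>Transfer between the three spaces\<close>

lemma weakly_null_wholeD:
  fixes f :: "'a::banach_lattice \<Rightarrow> real"
  assumes "weakly_null whole_space u" "bounded_linear f"
  shows "(\<lambda>n. f (u n)) \<longlonglongrightarrow> 0"
  using assms unfolding weakly_null_def bounded_functional_whole_space by blast

context ideal_projection
begin

lemma subspace_I: "subspace I"
  using ideal by (simp add: closed_ideal_def)

text \<open>For nonnegative x the two parts and their moduli have the same sum. The differences
  between modulus and part are nonnegative and add up to 0, so both vanish.\<close>

lemma nonneg_parts:
  assumes "0 \<le> x"
  shows "0 \<le> P x" "0 \<le> x - P x"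
proof -
  have "P x + (x - P x) = \<bar>P x\<bar> + \<bar>x - P x\<bar>" using abs_split[of x] assms by simp
  then have "(\<bar>P x\<bar> - P x) + (\<bar>x - P x\<bar> - (x - P x)) = 0" by (simp add: algebra_simps)
  moreover have "0 \<le> \<bar>P x\<bar> - P x" "0 \<le> \<bar>x - P x\<bar> - (x - P x)"
    by (simp_all only: diff_ge_0_iff_ge abs_ge_self)
  ultimately have "\<bar>P x\<bar> - P x = 0" "\<bar>x - P x\<bar> - (x - P x) = 0"
    by (simp_all only: add_nonneg_eq_0_iff)
  then show "0 \<le> P x" "0 \<le> x - P x" by (metis abs_ge_zero eq_iff_diff_eq_0)+
qed

lemma diff_P_cong:
  assumes "y \<in> I"
  shows "(x + y) - P (x + y) = x - P x"
  using assms by (simp add: linear_add[OF lin] P_id)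

lemma coset_eqD:
  assumes "coset I x = coset I y"
  shows "x - P x = y - P y"
proof -
  have "x \<in> coset I y" using assms subspace_0[OF subspace_I] by (auto simp: coset_def)
  then show ?thesis using diff_P_cong by (auto simp: coset_def)
qed

text \<open>The infimum is attained at the representative \<open>x - P x\<close>: every
  representative has this same complementary part, and \<open>1 - P\<close> does not increase
  norms.\<close>

lemma quotient_norm: "no_norm (quotient_space I) (coset I x) = norm (x - P x)"
  unfolding quotient_norm_coset
proof (rule cInf_eq_minimum)
  have "- P x \<in> I" using P_mem subspace_I by (simp add: subspace_neg)
  then show "norm (x - P x) \<in> (\<lambda>y. norm (x + y)) ` I"
    by (intro image_eqI[where x = "- P x"]) auto
next
  fix r assume "r \<in> (\<lambda>y. norm (x + y)) ` I"
  then obtain y where y: "y \<in> I" "r = norm (x + y)" by blast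
  have "norm ((x + y) - P (x + y)) \<le> norm (x + y)"
    using abs_split[of "x + y"] by (intro norm_lattice) simp
  then show "norm (x - P x) \<le> r" using y by (simp add: diff_P_cong)
qed

text \<open>A nonnegative coset contains a nonnegative element, and \<open>x - P x\<close> is the
  same for all elements of the coset.\<close>

lemma quotient_nonneg:
  assumes "no_le (quotient_space I) (no_zero (quotient_space I)) (coset I x)"
  shows "0 \<le> x - P x"
proof -
  obtain a y where "a \<in> I" "y \<in> I" "a \<le> x + y"
    using assms by (auto simp: quotient_space_def coset_def)
  then have "0 \<le> x + (y - a)" "y - a \<in> I"
    using subspace_I by (auto simp: algebra_simps subspace_diff)
  then show ?thesis using nonneg_parts(2) diff_P_cong by metis
qed

lemma weakly_null_P:
  assumes u: "weakly_null whole_space u"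
  shows "weakly_null (ideal_space I) (\<lambda>n. P (u n))"
  unfolding weakly_null_def
proof (intro conjI allI impI)
  show "P (u n) \<in> no_carrier (ideal_space I)" for n
    by (simp add: ideal_space_def P_mem)
  fix f assume "bounded_functional (ideal_space I) f"
  then obtain K where add: "\<And>a b. a \<in> I \<Longrightarrow> b \<in> I \<Longrightarrow> f (a + b) = f a + f b"
    and scale: "\<And>c a. a \<in> I \<Longrightarrow> f (c *\<^sub>R a) = c * f a"
    and K: "\<And>a. a \<in> I \<Longrightarrow> \<bar>f a\<bar> \<le> K * norm a"
    by (simp add: bounded_functional_def ideal_space_def whole_space_def) blast
  have "bounded_linear (\<lambda>x. f (P x))"
  proof (rule bounded_linear_intro)
    fix x
    have "\<bar>f (P x)\<bar> \<le> K * norm (P x)" by (rule K[OF P_mem])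
    also have "\<dots> \<le> \<bar>K\<bar> * norm x"
      using abs_split[of x] by (intro mult_mono norm_lattice) auto
    finally show "norm (f (P x)) \<le> norm x * \<bar>K\<bar>" by (simp add: mult.commute)
  qed (simp_all add: linear_add[OF lin] linear_scale[OF lin] add scale P_mem)
  then show "(\<lambda>n. f (P (u n))) \<longlonglongrightarrow> 0" by (rule weakly_null_wholeD[OF u])
qed

lemma weakly_null_complement:
  assumes u: "weakly_null (quotient_space I) (\<lambda>n. coset I (u n))"
  shows "weakly_null whole_space (\<lambda>n. u n - P (u n))"
  unfolding weakly_null_def bounded_functional_whole_space
proof (intro conjI allI impI)
  show "u n - P (u n) \<in> no_carrier whole_space" for n by (simp add: whole_space_def)
  fix f :: "'a \<Rightarrow> real" assume f: "bounded_linear f"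
  then interpret f: bounded_linear f .
  \<comment> \<open>\<open>g\<close> transports f to the quotient through an arbitrary
    representative of each coset. By \<open>coset_eqD\<close> the choice does not affect the
    value.\<close>
  define g where "g A = f (inv (coset I) A - P (inv (coset I) A))" for A
  have g: "g (coset I x) = f (x - P x)" for x
  proof -
    have "coset I (inv (coset I) (coset I x)) = coset I x" by (simp add: f_inv_into_f)
    then show ?thesis unfolding g_def by (metis coset_eqD)
  qed
  obtain K where K: "\<And>x. norm (f x) \<le> norm x * K" using f.bounded by blast
  have "bounded_functional (quotient_space I) g"
    unfolding bounded_functional_def
  proof (intro conjI ballI allI exI[of _ K])
    fix A assume "A \<in> no_carrier (quotient_space I)"
    then obtain x where A: "A = coset I x" by (auto simp: quotient_space_def)
    show "g (no_add (quotient_space I) A B) = g A + g B"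
      if B_mem: "B \<in> no_carrier (quotient_space I)" for B
    proof -
      obtain y where B: "B = coset I y" using B_mem by (auto simp: quotient_space_def)
      show ?thesis
        unfolding A B quotient_add_coset[OF ideal] g
        by (simp add: linear_add[OF lin] f.add f.diff)
    qed
    show "g (no_scale (quotient_space I) c A) = c * g A" for c
      unfolding A quotient_scale_coset[OF ideal] g
      by (simp add: linear_scale[OF lin] f.scaleR f.diff algebra_simps)
    show "\<bar>g A\<bar> \<le> K * no_norm (quotient_space I) A"
      using K[of "x - P x"] by (simp add: A g quotient_norm mult.commute)
  qed
  then show "(\<lambda>n. f (u n - P (u n))) \<longlonglongrightarrow> 0"
    using u unfolding weakly_null_def g[symmetric] by blast
qed

lemma weakly_null_coset:
  assumes u: "weakly_null whole_space u"
  shows "weakly_null (quotient_space I) (\<lambda>n. coset I (u n))"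
  unfolding weakly_null_def
proof (intro conjI allI impI)
  show "coset I (u n) \<in> no_carrier (quotient_space I)" for n
    by (simp add: quotient_space_def)
  fix g assume g: "bounded_functional (quotient_space I) g"
  have carrier: "coset I x \<in> no_carrier (quotient_space I)" for x
    by (simp add: quotient_space_def)
  obtain K where K: "\<And>x. \<bar>g (coset I x)\<bar> \<le> K * norm (x - P x)"
    using g carrier unfolding bounded_functional_def quotient_norm[symmetric] by blast
  have "bounded_linear (\<lambda>x. g (coset I x))"
  proof (rule bounded_linear_intro)
    show "g (coset I (x + y)) = g (coset I x) + g (coset I y)" for x y
      using g carrier unfolding bounded_functional_def quotient_add_coset[OF ideal, symmetric]
      by blast
    show "g (coset I (c *\<^sub>R x)) = c *\<^sub>R g (coset I x)" for c x
      using g carrier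
      unfolding bounded_functional_def quotient_scale_coset[OF ideal, symmetric] real_scaleR_def
      by blast
    fix x
    have "\<bar>g (coset I x)\<bar> \<le> K * norm (x - P x)" by (rule K)
    also have "\<dots> \<le> \<bar>K\<bar> * norm x"
      using abs_split[of x] by (intro mult_mono norm_lattice) auto
    finally show "norm (g (coset I x)) \<le> norm x * \<bar>K\<bar>" by (simp add: mult.commute)
  qed
  then show "(\<lambda>n. g (coset I (u n))) \<longlonglongrightarrow> 0" by (rule weakly_null_wholeD[OF u])
qed

lemma norm_null_quotient_iff:
  "norm_null (quotient_space I) (\<lambda>n. coset I (u n)) \<longleftrightarrow>
   (\<lambda>n. norm (u n - P (u n))) \<longlonglongrightarrow> 0"
  by (simp add: norm_null_def quotient_norm) (simp add: quotient_space_def)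

lemma quotient_sequence:
  assumes "weakly_null (quotient_space I) A"
  obtains u where "A = (\<lambda>n. coset I (u n))"
proof -
  have "\<forall>n. A n \<in> range (coset I)"
    using assms by (simp add: weakly_null_def quotient_space_def)
  then have "\<forall>n. \<exists>x. A n = coset I x" by blast
  then show thesis using that by metis
qed

lemma norm_null_from_parts:
  assumes "norm_null (ideal_space I) (\<lambda>n. P (u n))"
    and "norm_null (quotient_space I) (\<lambda>n. coset I (u n))"
  shows "norm_null whole_space u"
proof -
  have "(\<lambda>n. P (u n)) \<longlonglongrightarrow> 0" "(\<lambda>n. u n - P (u n)) \<longlonglongrightarrow> 0"
    using assms
    by (auto simp: norm_null_quotient_iff tendsto_norm_zero_iff)
      (auto simp: norm_null_def ideal_space_def whole_space_def tendsto_norm_zero_iff)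
  from tendsto_add[OF this] have "u \<longlonglongrightarrow> 0" by simp
  then show ?thesis by (simp add: norm_null_def whole_space_def tendsto_norm_zero_iff)
qed

section \<open>Schur properties of E/I and of E obtained from the projection\<close>

lemma schur_quotient:
  assumes E: "schur_property (whole_space :: 'a normed_order)"
  shows "schur_property (quotient_space I)"
  unfolding schur_property_def
proof (intro allI impI)
  fix A assume A: "weakly_null (quotient_space I) A"
  then obtain u where u: "A = (\<lambda>n. coset I (u n))" by (rule quotient_sequence)
  \<comment> \<open>The cosets are lifted to their minimal representatives; these are weakly null in
    E and have exactly the norms of the cosets.\<close>
  then have "norm_null whole_space (\<lambda>n. u n - P (u n))"
    using E A weakly_null_complement by (auto simp: schur_property_def)
  then show "norm_null (quotient_space I) A"
    unfolding u norm_null_quotient_iff by (simp add: norm_null_def whole_space_def)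
qed

lemma positive_schur_quotient:
  assumes E: "positive_schur_property (whole_space :: 'a normed_order)"
  shows "positive_schur_property (quotient_space I)"
  unfolding positive_schur_property_def
proof (intro allI impI, elim conjE)
  fix A assume A: "weakly_null (quotient_space I) A"
    and nonneg: "\<forall>n. no_le (quotient_space I) (no_zero (quotient_space I)) (A n)"
  obtain u where u: "A = (\<lambda>n. coset I (u n))" using A by (rule quotient_sequence)
  have "0 \<le> u n - P (u n)" for n using nonneg u by (intro quotient_nonneg) simp
  then have "no_le whole_space (no_zero whole_space) (u n - P (u n))" for n
    by (simp add: whole_space_def)
  then have "norm_null whole_space (\<lambda>n. u n - P (u n))"
    using E A weakly_null_complement u unfolding positive_schur_property_def by blast
  then show "norm_null (quotient_space I) A"
    unfolding u norm_null_quotient_iff by (simp add: norm_null_def whole_space_def)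
qed

lemma schur_whole:
  assumes "schur_property (ideal_space I)" "schur_property (quotient_space I)"
  shows "schur_property (whole_space :: 'a normed_order)"
  using assms weakly_null_P weakly_null_coset norm_null_from_parts
  unfolding schur_property_def by blast

lemma positive_schur_whole:
  assumes IP: "positive_schur_property (ideal_space I)"
    and Q: "positive_schur_property (quotient_space I)"
  shows "positive_schur_property (whole_space :: 'a normed_order)"
  unfolding positive_schur_property_def
proof (intro allI impI, elim conjE)
  fix u :: "nat \<Rightarrow> 'a"
  assume u: "weakly_null whole_space u"
    and nonneg: "\<forall>n. no_le whole_space (no_zero whole_space) (u n)"
  have u0: "0 \<le> u n" for n using nonneg by (simp add: whole_space_def)
  have "no_le (ideal_space I) (no_zero (ideal_space I)) (P (u n))" for n
    using nonneg_parts(1)[OF u0] by (simp add: ideal_space_def whole_space_def)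
  then have "norm_null (ideal_space I) (\<lambda>n. P (u n))"
    using IP weakly_null_P[OF u] unfolding positive_schur_property_def by blast
  moreover have "no_le (quotient_space I) (no_zero (quotient_space I)) (coset I (u n))" for n
  proof -
    have "x \<in> coset I x" for x
      using subspace_0[OF subspace_I] by (auto simp: coset_def)
    then show ?thesis using u0 by (auto simp: quotient_space_def)
  qed
  then have "norm_null (quotient_space I) (\<lambda>n. coset I (u n))"
    using Q weakly_null_coset[OF u] unfolding positive_schur_property_def by blast
  ultimately show "norm_null whole_space u" by (rule norm_null_from_parts)
qed

end

section \<open>Passage from E to I, and the conclusion\<close>

lemma weakly_null_ideal:
  assumes "weakly_null (ideal_space I) u"
  shows "weakly_null whole_space u" "\<forall>n. u n \<in> I"
proof -
  \<comment> \<open>The conditions on a functional only range over the carrier, so functionals on E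
    restrict to I.\<close>
  have "bounded_functional (ideal_space I) f" if "bounded_functional whole_space f" for f
    using that by (auto simp: bounded_functional_def ideal_space_def whole_space_def)
  then show "weakly_null whole_space u" "\<forall>n. u n \<in> I"
    using assms by (auto simp: weakly_null_def ideal_space_def whole_space_def)
qed

lemma positive_schur_if_schur: "schur_property X \<Longrightarrow> positive_schur_property X"
  by (simp add: schur_property_def positive_schur_property_def)

theorem theorem2p5:
  fixes I :: "'a::banach_lattice set"
  assumes "closed_ideal I"
  shows "
    ((schur_property (whole_space :: 'a normed_order) \<and>
      schur_property (ideal_space I) \<longrightarrow>
      schur_property (quotient_space I)) \<and>
     (schur_property (whole_space :: 'a normed_order) \<and>
      schur_property (quotient_space I) \<longrightarrow>
      schur_property (ideal_space I)) \<and>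
     (schur_property (ideal_space I) \<and>
      schur_property (quotient_space I) \<longrightarrow>
      schur_property (whole_space :: 'a normed_order))) \<and>
    ((positive_schur_property (whole_space :: 'a normed_order) \<and>
      positive_schur_property (ideal_space I) \<longrightarrow>
      positive_schur_property (quotient_space I)) \<and>
     (positive_schur_property (whole_space :: 'a normed_order) \<and>
      positive_schur_property (quotient_space I) \<longrightarrow>
      positive_schur_property (ideal_space I)) \<and>
     (positive_schur_property (ideal_space I) \<and>
      positive_schur_property (quotient_space I) \<longrightarrow>
      positive_schur_property (whole_space :: 'a normed_order)))"
proof -
  have null: "norm_null whole_space u \<longleftrightarrow> norm_null (ideal_space I) u" if "\<forall>n. u n \<in> I" for u
    using that by (simp add: norm_null_def ideal_space_def whole_space_def)
  have le: "no_le (ideal_space I) (no_zero (ideal_space I)) x \<longleftrightarrow>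
      no_le whole_space (no_zero whole_space) x" for x
    by (simp add: ideal_space_def)
  have schur_ideal: "schur_property (ideal_space I)" if "schur_property (whole_space :: 'a normed_order)"
    using that weakly_null_ideal null unfolding schur_property_def by blast
  have positive_schur_ideal: "positive_schur_property (ideal_space I)"
    if "positive_schur_property (whole_space :: 'a normed_order)"
    using that weakly_null_ideal null unfolding positive_schur_property_def le by blast
  show ?thesis
  \<comment> \<open>If I has the positive Schur property, the projection is available. If not, I
    does not have the Schur property either, and E has neither property because I would inherit it;
    then each of the six implications has a false premise.\<close>
  proof (cases "positive_schur_property (ideal_space I)")
    case True
    then obtain P where "ideal_projection I P"
      using ideal_projection_exists[OF assms] by blast
    then interpret ideal_projection I P .
    show ?thesis
      using schur_ideal positive_schur_ideal schur_quotient positive_schur_quotient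
        schur_whole positive_schur_whole by blast
  next
    case False
    then show ?thesis
      using schur_ideal positive_schur_ideal positive_schur_if_schur by blast
  qed
qed

end
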